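(* Let $n \ge 3$ be an integer and let $U_1, \dots, U_n$ be independent random variables, each uniformly distributed on $[0,1]$. Then the probability that no four of the numbers $U_1,\dots,U_n$ can form a quadrilateral (that is, that there are no four distinct indices $a,b,c,d \in \{1,\dots,n\}$ such that $U_a, U_b, U_c, U_d$ are the side lengths of a quadrilateral) equals $$\frac{1}{T_n - T_{n-2}} \prod_{i=1}^{n-1} \frac{1}{T_i},$$ where $(T_k)_{k \ge 1}$ are the Tribonacci numbers defined by $T_1 = 1$, $T_2 = 1$, $T_3 = 2$, and $T_k = T_{k-1} + T_{k-2} + T_{k-3}$ for $k > 3$.
   Context: Four nonnegative real numbers can form a quadrilateral if each of them is strictly less than the sum of the other three. Equivalently, four numbers $w \le x \le y \le z$ cannot form a quadrilateral exactly when $w + x + y \le z$. *)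

theory Defs
  imports "HOL-Probability.Probability"
begin

definition can_form_quadrilateral :: "real \<Rightarrow> real \<Rightarrow> real \<Rightarrow> real \<Rightarrow> bool" where
  "can_form_quadrilateral w x y z \<longleftrightarrow>
     0 \<le> w \<and> 0 \<le> x \<and> 0 \<le> y \<and> 0 \<le> z \<and>
     w < x + y + z \<and> x < w + y + z \<and> y < w + x + z \<and> z < w + x + y"

(* The sequence starts at index 1; the value at 0 is a dummy. *)
fun tribonacci :: "nat \<Rightarrow> nat" where
  "tribonacci 0 = 0"
| "tribonacci (Suc 0) = 1"
| "tribonacci (Suc (Suc 0)) = 1"
| "tribonacci (Suc (Suc (Suc 0))) = 2"
| "tribonacci (Suc (Suc (Suc (Suc k)))) =
     tribonacci (Suc (Suc (Suc k))) + tribonacci (Suc (Suc k)) + tribonacci (Suc k)"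

end

theory Submission
  imports Defs
begin

text \<open>Almost surely the numbers are distinct, so by symmetry the probability is $n!$ times the volume
  of the set of sorted points without a quadrilateral. For sorted numbers this means that
  $x_{i-3} + x_{i-2} + x_{i-1} \le x_i$ for all $i > 3$. In the unimodular coordinates
  $y_1 = x_1$, $y_2 = x_2 - x_1$, $y_3 = x_3 - x_2$, $y_i = x_i - x_{i-1} - x_{i-2} - x_{i-3}$ the set is
  given by $y_i \ge 0$ and $x_n \le 1$, and $x_n$ is a linear combination of the $y_i$ with positive
  coefficients $b_i$. This is a simplex of volume $1 / (n! \prod b_i)$, and the $b_i$
  are $T_{n+1-i}$ for $i \ge 2$ and $T_n - T_{n-2}$ for $i = 1$.\<close>

subsection \<open>Integration over the simplex in excess coordinates\<close>

text \<open>The least value open to entry \<open>i\<close> once its predecessors are chosen: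
  nonnegativity first, then sortedness, and from the fourth entry on the absence of a quadrilateral
  with the three preceding entries.\<close>

definition admissible_lower :: "(nat \<Rightarrow> real) \<Rightarrow> nat \<Rightarrow> real" where
  "admissible_lower x i =
     (if i \<le> 1 then 0 else if i \<le> 3 then x (i - 1) else x (i - 1) + x (i - 2) + x (i - 3))"

abbreviation excess :: "(nat \<Rightarrow> real) \<Rightarrow> nat \<Rightarrow> real" where
  "excess x i \<equiv> x i - admissible_lower x i"

abbreviation lborel_power :: "nat \<Rightarrow> (nat \<Rightarrow> real) measure" where
  "lborel_power n \<equiv> Pi\<^sub>M {1..n} (\<lambda>_. lborel)"

text \<open>The bound at \<open>i\<close> reads only entries before \<open>i\<close>. This
  triangularity lets the last coordinate be integrated out without disturbing the earlier
  excesses.\<close>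

lemma admissible_lower_upd [simp]:
  "1 \<le> i \<Longrightarrow> i \<le> k \<Longrightarrow> admissible_lower (x(k := y)) i = admissible_lower x i"
  by (auto simp: admissible_lower_def)

lemma measurable_admissible_lower [measurable]:
  assumes "sets (N :: (nat \<Rightarrow> real) measure) = sets (Pi\<^sub>M {1..n} (\<lambda>_. borel))" "i \<le> Suc n"
  shows "(\<lambda>x. admissible_lower x i) \<in> borel_measurable N"
proof -
  have [measurable]: "(\<lambda>x. x j) \<in> borel_measurable N" if "1 \<le> j" "j \<le> n" for j
    unfolding measurable_cong_sets[OF assms(1) refl]
    by (rule measurable_component_singleton) (use that in auto)
  show ?thesis
    using assms(2)
    by (cases "i \<le> 1"; cases "i \<le> 3") (simp_all add: admissible_lower_def)
qed

lemma sets_lborel_power: "sets (lborel_power n) = sets (Pi\<^sub>M {1..n} (\<lambda>_. borel))"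
  by (rule sets_PiM_cong) auto

text \<open>For \<open>s\<close> nonnegative the integrand lives on \<open>[l, l + s / b]\<close>,
  and the antiderivative vanishes at the right end; for negative \<open>s\<close> the support is
  empty. The truncation is explicit because for \<open>m = 0\<close> the power alone is 1
  everywhere.\<close>

lemma nn_integral_truncated_power:
  fixes l s b :: real
  assumes "b > 0"
  shows "(\<integral>\<^sup>+x. ennreal (if l \<le> x \<and> b * (x - l) \<le> s then (s - b * (x - l)) ^ m else 0) \<partial>lborel)
       = ennreal (if 0 \<le> s then s ^ Suc m / (b * real (Suc m)) else 0)"
proof (cases "0 \<le> s")
  case True
  have "(\<integral>\<^sup>+x. ennreal (if l \<le> x \<and> b * (x - l) \<le> s then (s - b * (x - l)) ^ m else 0) \<partial>lborel)
      = (\<integral>\<^sup>+x. ennreal ((s - b * (x - l)) ^ m) * indicator {l..l + s / b} x \<partial>lborel)"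
    using assms by (intro nn_integral_cong) (auto simp: field_simps split: split_indicator)
  also have "\<dots> = ennreal (- ((s - b * (l + s / b - l)) ^ Suc m / (b * real (Suc m)))
                        - - ((s - b * (l - l)) ^ Suc m / (b * real (Suc m))))"
  proof (rule nn_integral_FTC_Icc)
    show "l \<le> l + s / b" using assms True by simp
    show "((\<lambda>x. - ((s - b * (x - l)) ^ Suc m / (b * real (Suc m))))
        has_real_derivative (s - b * (x - l)) ^ m) (at x)" for x
      by (rule derivative_eq_intros refl | use assms in \<open>simp add: field_simps del: of_nat_Suc\<close>)+
    show "0 \<le> (s - b * (x - l)) ^ m" if "x \<in> {l..l + s / b}" for x
      using that assms by (intro zero_le_power) (simp add: field_simps)
  qed auto
  also have "\<dots> = ennreal (s ^ Suc m / (b * real (Suc m)))"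
    using assms by simp
  finally show ?thesis
    using True by simp
next
  case False
  have "(l \<le> x \<and> b * (x - l) \<le> s) = False" for x
  proof -
    have "0 \<le> b * (x - l)" if "l \<le> x"
      using that assms by simp
    then show ?thesis
      using False by auto
  qed
  then show ?thesis
    using False by (simp only:) simp
qed

text \<open>The affine excess coordinates triangularise the region, so that the last coordinate can be
  integrated out by translation alone, which raises the truncated power by one.\<close>
lemma nn_integral_excess_simplex:
  assumes "\<And>i. i \<in> {1..k} \<Longrightarrow> b i > 0"
  shows "(\<integral>\<^sup>+x. ennreal (if (\<forall>i\<in>{1..k}. 0 \<le> excess x i) \<and> (\<Sum>i=1..k. b i * excess x i) \<le> 1
              then (1 - (\<Sum>i=1..k. b i * excess x i)) ^ m else 0) \<partial>lborel_power k)
       = ennreal (fact m / (fact (m + k) * (\<Prod>i=1..k. b i)))"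
  using assms
proof (induction k arbitrary: m)
  case 0
  then show ?case
    by (simp add: PiM_empty nn_integral_count_space_finite)
next
  case (Suc k)
  interpret product_sigma_finite "\<lambda>_ :: nat. lborel :: real measure"
    by standard
  define S where "S k x = (\<Sum>i=1..k. b i * excess x i)" for k x
  \<comment> \<open>\<open>F k m\<close> is the \<open>m\<close>-th power of the slack left by the
    first \<open>k\<close> coordinates, cut off outside the simplex.\<close>
  define F where "F k m x =
    (if (\<forall>i\<in>{1..k}. 0 \<le> excess x i) \<and> S k x \<le> 1 then (1 - S k x) ^ m else 0)" for k m x
  have meas: "(\<lambda>x. F k m x) \<in> borel_measurable (lborel_power k)" for k m
  proof -
    have [measurable]: "(\<lambda>x. excess x i) \<in> borel_measurable (lborel_power k)" if "i \<in> {1..k}" for i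
      using that measurable_admissible_lower[OF sets_lborel_power, of i k]
      by (intro borel_measurable_diff)
         (auto simp: measurable_cong_sets[OF sets_lborel_power refl] intro!: measurable_component_singleton)
    show ?thesis
      unfolding F_def S_def by measurable
  qed
  have b: "b (Suc k) > 0" by (rule Suc.prems) simp
  have split: "{1..Suc k} = insert (Suc k) {1..k}" by auto
  have S_upd: "S k (x(Suc k := y)) = S k x" for x y
    unfolding S_def by (intro sum.cong) auto
  \<comment> \<open>With the first \<open>k\<close> coordinates fixed, the slack
    \<open>1 - S k x\<close> takes the role of \<open>s\<close> and
    \<open>admissible_lower x (Suc k)\<close> that of \<open>l\<close>. If an earlier excess is
    negative, both sides are 0.\<close>
  have inner: "(\<integral>\<^sup>+y. ennreal (F (Suc k) m (x(Suc k := y))) \<partial>lborel)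
      = ennreal (F k (Suc m) x) * ennreal (1 / (b (Suc k) * real (Suc m)))" for x
  proof (cases "\<forall>i\<in>{1..k}. 0 \<le> excess x i")
    case True
    let ?l = "admissible_lower x (Suc k)"
    have "F (Suc k) m (x(Suc k := y)) =
        (if ?l \<le> y \<and> b (Suc k) * (y - ?l) \<le> 1 - S k x
         then (1 - S k x - b (Suc k) * (y - ?l)) ^ m else 0)" for y
    proof -
      have "S (Suc k) (x(Suc k := y)) = S k x + b (Suc k) * (y - ?l)"
        using S_upd[of x y] by (simp add: S_def)
      moreover have "(\<forall>i\<in>{1..Suc k}. 0 \<le> excess (x(Suc k := y)) i) \<longleftrightarrow> ?l \<le> y"
        using True unfolding split by auto
      moreover have "S k x + c \<le> 1 \<longleftrightarrow> c \<le> 1 - S k x" "1 - (S k x + c) = 1 - S k x - c" for c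
        by auto
      ultimately show ?thesis
        unfolding F_def by (simp only:)
    qed
    then have "(\<integral>\<^sup>+y. ennreal (F (Suc k) m (x(Suc k := y))) \<partial>lborel)
        = ennreal (if 0 \<le> 1 - S k x then (1 - S k x) ^ Suc m / (b (Suc k) * real (Suc m)) else 0)"
      using nn_integral_truncated_power[OF b, of ?l "1 - S k x" m] by simp
    also have "\<dots> = ennreal (F k (Suc m) x * (1 / (b (Suc k) * real (Suc m))))"
      using True by (simp add: F_def)
    also have "\<dots> = ennreal (F k (Suc m) x) * ennreal (1 / (b (Suc k) * real (Suc m)))"
      by (rule ennreal_mult) (use b in \<open>auto simp: F_def\<close>)
    finally show ?thesis .
  next
    case False
    then obtain i where i: "i \<in> {1..k}" "\<not> 0 \<le> excess x i" by auto
    then have "\<not> 0 \<le> excess (x(Suc k := y)) i" for y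
      by simp
    then have "F (Suc k) m (x(Suc k := y)) = 0" for y
      unfolding F_def using i(1) split by (metis insertCI)
    moreover have "F k (Suc m) x = 0"
      using False by (auto simp: F_def)
    ultimately show ?thesis
      by simp
  qed
  \<comment> \<open>Integrating out one coordinate raises the exponent, so the hypothesis is needed
    at \<open>Suc m\<close>; this is why \<open>m\<close> is arbitrary in the induction.\<close>
  have IH: "(\<integral>\<^sup>+x. ennreal (F k (Suc m) x) \<partial>lborel_power k)
      = ennreal (fact (Suc m) / (fact (Suc m + k) * (\<Prod>i=1..k. b i)))"
    unfolding F_def S_def by (rule Suc.IH) (use Suc.prems in auto)
  have "(\<integral>\<^sup>+x. ennreal (F (Suc k) m x) \<partial>lborel_power (Suc k))
      = (\<integral>\<^sup>+x. (\<integral>\<^sup>+y. ennreal (F (Suc k) m (x(Suc k := y))) \<partial>lborel) \<partial>lborel_power k)"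
    using meas[of "Suc k" m] unfolding split
    by (intro product_nn_integral_insert) auto
  also have "\<dots> = (\<integral>\<^sup>+x. ennreal (F k (Suc m) x) \<partial>lborel_power k)
      * ennreal (1 / (b (Suc k) * real (Suc m)))"
    unfolding inner by (intro nn_integral_multc measurable_compose[OF meas]) auto
  also have "\<dots> = ennreal (fact (Suc m) / (fact (Suc m + k) * (\<Prod>i=1..k. b i))
      * (1 / (b (Suc k) * real (Suc m))))"
    unfolding IH using Suc.prems
    by (intro ennreal_mult[symmetric] divide_nonneg_nonneg mult_nonneg_nonneg prod_nonneg)
       (auto intro: less_imp_le)
  \<comment> \<open>The factor \<open>1 / Suc m\<close> turns (m+1)! into m!, and m+1+k = m+(k+1)
    leaves the other factorial as it is.\<close>
  also have "fact (Suc m) / (fact (Suc m + k) * (\<Prod>i=1..k. b i)) * (1 / (b (Suc k) * real (Suc m)))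
      = fact m / (fact (m + Suc k) * (\<Prod>i=1..Suc k. b i))"
    by (simp add: field_simps del: of_nat_Suc)
  finally show ?case
    unfolding F_def S_def .
qed

subsection \<open>Tribonacci weights\<close>

text \<open>The dummy value at index 0 extends the recurrence down to \<open>k = 0\<close>, where it
  reads 2 = 1 + 1 + 0.\<close>

lemma tribonacci_rec: "tribonacci (k + 3) = tribonacci (k + 2) + tribonacci (k + 1) + tribonacci k"
  by (cases k) (auto simp: numeral_eq_Suc)

lemma tribonacci_pos: "k \<ge> 1 \<Longrightarrow> tribonacci k > 0"
  by (induction k rule: tribonacci.induct) auto

text \<open>The coefficient of the $i$-th excess coordinate in $x_n$. The first one is exceptional because
  $x_1$ also enters $x_2$ and $x_3$ through the ordering constraints.\<close>
definition weight :: "nat \<Rightarrow> nat \<Rightarrow> real" where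
  "weight n i = (if i = 1 then real (tribonacci n) - real (tribonacci (n - 2))
     else real (tribonacci (n + 1 - i)))"

text \<open>Only the first weight needs an argument: T_n - T_(n-2) = T_(n-1) + T_(n-3), and T_(n-1)
  is positive.\<close>

lemma weight_pos:
  assumes "n \<ge> 3" "i \<in> {1..n}"
  shows "weight n i > 0"
proof -
  obtain j where j: "n = j + 3"
    using assms by (metis add.commute le_Suc_ex)
  have "real (tribonacci (j + 2)) > 0"
    using tribonacci_pos by simp
  then show ?thesis
    using assms tribonacci_pos[of "n + 1 - i"] tribonacci_rec[of j] unfolding weight_def j by fastforce
qed

text \<open>For $k = n$ the truncated index $n - k - 1$ stands for $-1$; the dummy value $T_0 = 0$ is the
  right one there.\<close>
lemma sum_weight_excess_partial:
  assumes "3 \<le> k" "k \<le> n"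
  shows "(\<Sum>i=1..k. weight n i * excess x i) =
    real (tribonacci (n + 1 - k)) * x k + (real (tribonacci (n - k)) + real (tribonacci (n - k - 1))) * x (k - 1)
      + real (tribonacci (n - k)) * x (k - 2)"
  using assms
proof (induction k rule: nat_induct_at_least)
  case base
  then obtain j where j: "n = j + 3"
    by (metis add.commute le_Suc_ex)
  \<comment> \<open>The coefficient of \<open>x 1\<close> is T_n - T_(n-2) - T_(n-1) = T_(n-3),
    which accounts for the exceptional first weight. The coefficient of \<open>x 2\<close> is
    T_(n-1) - T_(n-2); splitting on \<open>j\<close> isolates \<open>n = 3\<close>, where it is
    0.\<close>
  show ?case
    using tribonacci_rec[of j] tribonacci_rec[of "j - 1"]
    by (cases j)
       (simp_all add: j weight_def admissible_lower_def numeral_eq_Suc algebra_simps)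
next
  case (Suc k)
  then obtain j where j: "n = j + Suc k"
    by (metis add.commute le_Suc_ex)
  obtain i where i: "k = i + 3"
    using Suc.hyps by (metis add.commute le_Suc_ex)
  have IH: "(\<Sum>i=1..k. weight n i * excess x i) =
    real (tribonacci (n + 1 - k)) * x k + (real (tribonacci (n - k)) + real (tribonacci (n - k - 1))) * x (k - 1)
      + real (tribonacci (n - k)) * x (k - 2)"
    using Suc by simp
  \<comment> \<open>The new excess has weight T_(n-k). It cancels the term in
    \<open>x (k - 2)\<close>, leaves T_(n-k-1) at \<open>x (k - 1)\<close>, and changes the
    coefficient of \<open>x k\<close> to T_(n+1-k) - T_(n-k), which the recurrence splits into two
    terms.\<close>
  show ?case
    unfolding sum.cl_ivl_Suc IH
    using tribonacci_rec[of "j - 1"]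
    by (cases j) (simp_all add: i j weight_def admissible_lower_def numeral_eq_Suc algebra_simps)
qed

text \<open>At \<open>k = n\<close> the remaining coefficients are T_1 = 1 and T_0 = 0. Bounding the
  last entry by 1 is thus the slanted face of the simplex.\<close>

lemma sum_weight_excess: "n \<ge> 3 \<Longrightarrow> (\<Sum>i=1..n. weight n i * excess x i) = x n"
  using sum_weight_excess_partial[of n n x] by simp

lemma prod_weight:
  assumes "n \<ge> 1"
  shows "(\<Prod>i=1..n. weight n i) =
    (real (tribonacci n) - real (tribonacci (n - 2))) * (\<Prod>i=1..n - 1. real (tribonacci i))"
proof -
  have "(\<Prod>i=1..n. weight n i) = weight n 1 * (\<Prod>i=2..n. weight n i)"
    using assms by (simp add: prod.atLeast_Suc_atMost numeral_2_eq_2)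
  also have "(\<Prod>i=2..n. weight n i) = (\<Prod>i=1..n - 1. real (tribonacci i))"
    by (rule prod.reindex_bij_witness[of _ "\<lambda>i. n + 1 - i" "\<lambda>i. n + 1 - i"])
       (auto simp: weight_def)
  finally show ?thesis
    by (simp add: weight_def)
qed


subsection \<open>The admissible region\<close>

text \<open>The cone of sorted nonnegative points without a quadrilateral; the upper bound 1 is left
  to the unit box.\<close>

definition admissible :: "nat \<Rightarrow> (nat \<Rightarrow> real) \<Rightarrow> bool" where
  "admissible n x \<longleftrightarrow> (\<forall>i\<in>{1..n}. 0 \<le> excess x i)"

lemma admissible_nonneg:
  assumes "admissible n x" "i \<in> {1..n}"
  shows "0 \<le> x i"
  using assms(2)
proof (induction i rule: less_induct)
  case (less i)
  have "0 \<le> admissible_lower x i"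
    using less by (auto simp: admissible_lower_def intro!: add_nonneg_nonneg)
  moreover have "0 \<le> excess x i"
    using assms(1) less.prems unfolding admissible_def by blast
  ultimately show ?case by linarith
qed

text \<open>From the fourth entry on, the lower bound is the preceding entry plus two others, so
  sortedness follows from nonnegativity.\<close>

lemma admissible_mono:
  assumes "admissible n x" "1 \<le> i" "i \<le> j" "j \<le> n"
  shows "x i \<le> x j"
  using assms(3,4)
proof (induction j rule: dec_induct)
  case (step j)
  have nonneg: "0 \<le> x k" if "k \<in> {1..n}" for k
    using admissible_nonneg[OF assms(1) that] .
  have "x j \<le> admissible_lower x (Suc j)"
    using step assms(2) by (auto simp: admissible_lower_def numeral_eq_Suc intro!: add_nonneg_nonneg nonneg)
  moreover have "0 \<le> excess x (Suc j)"
    using assms(1) step unfolding admissible_def by simp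
  ultimately show ?case
    using step by simp
qed simp

lemma measurable_admissible [measurable]:
  assumes "sets (N :: (nat \<Rightarrow> real) measure) = sets (Pi\<^sub>M {1..n} (\<lambda>_. borel))"
  shows "Measurable.pred N (admissible n)"
proof -
  have [measurable]: "(\<lambda>x. excess x i) \<in> borel_measurable N" if "i \<in> {1..n}" for i
    using that measurable_admissible_lower[OF assms, of i]
    by (intro borel_measurable_diff)
       (auto simp: measurable_cong_sets[OF assms refl] intro!: measurable_component_singleton)
  show ?thesis
    unfolding admissible_def[abs_def] by measurable
qed

section \<open>The uniform measure on the unit cube and the volume of the admissible region\<close>

abbreviation uniform_power :: "nat \<Rightarrow> (nat \<Rightarrow> real) measure" where
  "uniform_power n \<equiv> Pi\<^sub>M {1..n} (\<lambda>_. uniform_measure lborel {0..1})"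

lemma sets_uniform_power: "sets (uniform_power n) = sets (Pi\<^sub>M {1..n} (\<lambda>_. borel))"
  by (rule sets_PiM_cong) auto

lemma prob_space_uniform_unit: "prob_space (uniform_measure lborel {0..1::real})"
  by (rule prob_space_uniform_measure) auto

text \<open>A sigma-finite product measure is determined by its values on boxes. There both sides
  agree, since the unit interval has length 1 and conditioning on it is mere intersection.\<close>

lemma uniform_power_eq_density:
  "uniform_power n = density (lborel_power n) (indicator (\<Pi>\<^sub>E i\<in>{1..n}. {0..1}))"
proof -
  interpret L: product_sigma_finite "\<lambda>_ :: nat. lborel :: real measure"
    by standard
  interpret V: product_sigma_finite "\<lambda>_ :: nat. uniform_measure lborel {0..1::real}"
    using prob_space_uniform_unit by (simp add: product_sigma_finite_def prob_space_imp_sigma_finite)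
  have box: "(\<Pi>\<^sub>E i\<in>{1..n}. {0..1}) \<in> sets (lborel_power n)"
    by (intro sets_PiM_I_finite) auto
  show ?thesis
  proof (rule V.PiM_eqI[symmetric])
    show "sets (density (lborel_power n) (indicator (\<Pi>\<^sub>E i\<in>{1..n}. {0..1}))) = sets (uniform_power n)"
      by (simp only: sets_density sets_lborel_power sets_uniform_power)
    fix A :: "nat \<Rightarrow> real set"
    assume "\<And>i. i \<in> {1..n} \<Longrightarrow> A i \<in> sets (uniform_measure lborel {0..1})"
    then have A: "\<And>i. i \<in> {1..n} \<Longrightarrow> A i \<in> sets borel"
      by simp
    have "emeasure (density (lborel_power n) (indicator (\<Pi>\<^sub>E i\<in>{1..n}. {0..1}))) (Pi\<^sub>E {1..n} A)
        = emeasure (lborel_power n) ((\<Pi>\<^sub>E i\<in>{1..n}. {0..1}) \<inter> Pi\<^sub>E {1..n} A)"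
      using A by (intro emeasure_restricted box sets_PiM_I_finite) auto
    also have "\<dots> = emeasure (lborel_power n) (\<Pi>\<^sub>E i\<in>{1..n}. {0..1} \<inter> A i)"
      by (simp add: PiE_Int)
    also have "\<dots> = (\<Prod>i\<in>{1..n}. emeasure lborel ({0..1} \<inter> A i))"
      using A by (intro L.emeasure_PiM) auto
    also have "\<dots> = (\<Prod>i\<in>{1..n}. emeasure (uniform_measure lborel {0..1}) (A i))"
      using A by (intro prod.cong) (auto simp: emeasure_uniform_measure divide_ennreal_def)
    finally show "emeasure (density (lborel_power n) (indicator (\<Pi>\<^sub>E i\<in>{1..n}. {0..1}))) (Pi\<^sub>E {1..n} A)
        = (\<Prod>i\<in>{1..n}. emeasure (uniform_measure lborel {0..1}) (A i))" .
  qed simp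
qed

lemma emeasure_admissible:
  assumes "n \<ge> 3"
  shows "emeasure (uniform_power n) {x \<in> space (uniform_power n). admissible n x}
       = ennreal (1 / (fact n * (\<Prod>i=1..n. weight n i)))"
proof -
  let ?B = "\<Pi>\<^sub>E i\<in>{1..n}. {0..1::real}"
  have box: "?B \<in> sets (lborel_power n)"
    by (intro sets_PiM_I_finite) auto
  note [measurable] = measurable_admissible[OF sets_lborel_power]
  have Q: "{x \<in> space (lborel_power n). admissible n x} \<in> sets (lborel_power n)"
    by measurable
  \<comment> \<open>Admissible points are nonnegative and sorted, so all box constraints reduce to
    the one on the largest entry.\<close>
  have in_box: "x \<in> ?B \<longleftrightarrow> x n \<le> 1" if "x \<in> space (lborel_power n)" "admissible n x" for x
  proof
    assume "x n \<le> 1"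
    have "x i \<in> {0..1}" if "i \<in> {1..n}" for i
      using admissible_nonneg[OF \<open>admissible n x\<close> that]
        admissible_mono[OF \<open>admissible n x\<close>, of i n] that \<open>x n \<le> 1\<close> by auto
    then show "x \<in> ?B"
      using \<open>x \<in> space (lborel_power n)\<close> by (auto simp: space_PiM PiE_iff)
  next
    assume "x \<in> ?B"
    then show "x n \<le> 1"
      using assms by (auto dest: PiE_mem[of _ _ _ n])
  qed
  have "space (uniform_power n) = space (lborel_power n)"
    by (simp add: space_PiM)
  then have "emeasure (uniform_power n) {x \<in> space (uniform_power n). admissible n x}
      = emeasure (lborel_power n) (?B \<inter> {x \<in> space (lborel_power n). admissible n x})"
    by (simp only: uniform_power_eq_density space_density emeasure_restricted[OF box Q])
  also have "\<dots> = (\<integral>\<^sup>+x. indicator (?B \<inter> {x \<in> space (lborel_power n). admissible n x}) x \<partial>lborel_power n)"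
    using box Q by simp
  \<comment> \<open>With exponent 0 the truncated power is the indicator of the simplex, so its
    integral is the volume.\<close>
  also have "\<dots> = (\<integral>\<^sup>+x. ennreal (if (\<forall>i\<in>{1..n}. 0 \<le> excess x i) \<and> (\<Sum>i=1..n. weight n i * excess x i) \<le> 1
              then (1 - (\<Sum>i=1..n. weight n i * excess x i)) ^ 0 else 0) \<partial>lborel_power n)"
  proof (rule nn_integral_cong)
    fix x assume "x \<in> space (lborel_power n)"
    then show "indicator (?B \<inter> {x \<in> space (lborel_power n). admissible n x}) x =
        ennreal (if (\<forall>i\<in>{1..n}. 0 \<le> excess x i) \<and> (\<Sum>i=1..n. weight n i * excess x i) \<le> 1
              then (1 - (\<Sum>i=1..n. weight n i * excess x i)) ^ 0 else 0)"
      using in_box[of x] unfolding sum_weight_excess[OF assms] admissible_def[symmetric]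
      by (auto split: split_indicator)
  qed
  also have "\<dots> = ennreal (fact 0 / (fact (0 + n) * (\<Prod>i=1..n. weight n i)))"
    by (rule nn_integral_excess_simplex) (rule weight_pos[OF assms])
  finally show ?thesis
    by simp
qed


subsection \<open>Sorting permutations and quadrilaterals\<close>

definition quadrilateral_free :: "nat \<Rightarrow> (nat \<Rightarrow> real) \<Rightarrow> bool" where
  "quadrilateral_free n x \<longleftrightarrow>
     \<not> (\<exists>a\<in>{1..n}. \<exists>b\<in>{1..n}. \<exists>c\<in>{1..n}. \<exists>d\<in>{1..n}. distinct [a, b, c, d] \<and>
          can_form_quadrilateral (x a) (x b) (x c) (x d))"

lemma quadrilateral_free_permute:
  assumes "p permutes {1..n}"
  shows "quadrilateral_free n (x \<circ> p) \<longleftrightarrow> quadrilateral_free n x"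
proof -
  \<comment> \<open>As \<open>p\<close> maps the index set onto itself, each bounded quantifier can
    be reindexed; this is done from the innermost one outwards.\<close>
  have ex: "(\<exists>a\<in>{1..n}. P (p a)) \<longleftrightarrow> (\<exists>a\<in>{1..n}. P a)" for P
    using permutes_image[OF assms] by (metis imageE imageI)
  let ?P = "\<lambda>a b c d. distinct [a, b, c, d] \<and> can_form_quadrilateral (x a) (x b) (x c) (x d)"
  have "quadrilateral_free n (x \<circ> p) \<longleftrightarrow>
      \<not> (\<exists>a\<in>{1..n}. \<exists>b\<in>{1..n}. \<exists>c\<in>{1..n}. \<exists>d\<in>{1..n}. ?P (p a) (p b) (p c) (p d))"
    by (simp add: quadrilateral_free_def inj_eq[OF permutes_inj[OF assms]])
  also have "\<dots> \<longleftrightarrow> quadrilateral_free n x"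
    unfolding quadrilateral_free_def
    by (simp only: ex[of "\<lambda>d. ?P a b c d" for a b c] ex[of "\<lambda>c. \<exists>d\<in>{1..n}. ?P a b c d" for a b]
        ex[of "\<lambda>b. \<exists>c\<in>{1..n}. \<exists>d\<in>{1..n}. ?P a b c d" for a]
        ex[of "\<lambda>a. \<exists>b\<in>{1..n}. \<exists>c\<in>{1..n}. \<exists>d\<in>{1..n}. ?P a b c d"])
  finally show ?thesis .
qed

text \<open>By monotonicity, three distinct entries before \<open>d\<close> are dominated by the
  three immediate predecessors of \<open>d\<close>, whose sum bounds \<open>x d\<close> from below.
  The sum is symmetric, so ordered triples suffice.\<close>

lemma admissible_three_le:
  assumes adm: "admissible n x" and mem: "{a, b, c} \<subseteq> {1..<d}" and dn: "d \<le> n"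
    and dist: "distinct [a, b, c]"
  shows "x a + x b + x c \<le> x d"
proof -
  have ordered: "x a + x b + x c \<le> x d" if "1 \<le> a" "a < b" "b < c" "c < d" for a b c
  proof -
    have "x a \<le> x (d - 3)" "x b \<le> x (d - 2)" "x c \<le> x (d - 1)"
      using that dn by (auto intro!: admissible_mono[OF adm])
    moreover have "0 \<le> excess x d"
      using adm that dn unfolding admissible_def by simp
    ultimately show ?thesis
      using that by (simp add: admissible_lower_def)
  qed
  show ?thesis
    using mem dist ordered[of a b c] ordered[of a c b] ordered[of b a c]
      ordered[of b c a] ordered[of c a b] ordered[of c b a]
    by (cases a b rule: linorder_cases; cases b c rule: linorder_cases; cases a c rule: linorder_cases) auto
qed

lemma quadrilateral_free_if_admissible:
  assumes "admissible n x"
  shows "quadrilateral_free n x"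
  unfolding quadrilateral_free_def
proof (intro notI, elim bexE conjE)
  fix a b c d
  assume mem: "a \<in> {1..n}" "b \<in> {1..n}" "c \<in> {1..n}" "d \<in> {1..n}"
    and dist: "distinct [a, b, c, d]"
    and quad: "can_form_quadrilateral (x a) (x b) (x c) (x d)"
  \<comment> \<open>The entry at the largest of the four indices is at least the sum of the other
    three.\<close>
  consider "a \<le> d \<and> b \<le> d \<and> c \<le> d" | "b \<le> a \<and> c \<le> a \<and> d \<le> a"
    | "a \<le> b \<and> c \<le> b \<and> d \<le> b" | "a \<le> c \<and> b \<le> c \<and> d \<le> c"
    by linarith
  then show False
  proof cases
    case 1
    then show ?thesis using admissible_three_le[OF assms, of a b c d] mem dist quad
      by (auto simp: can_form_quadrilateral_def)
  next
    case 2
    then show ?thesis using admissible_three_le[OF assms, of b c d a] mem dist quad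
      by (auto simp: can_form_quadrilateral_def)
  next
    case 3
    then show ?thesis using admissible_three_le[OF assms, of a c d b] mem dist quad
      by (auto simp: can_form_quadrilateral_def)
  next
    case 4
    then show ?thesis using admissible_three_le[OF assms, of a b d c] mem dist quad
      by (auto simp: can_form_quadrilateral_def)
  qed
qed

text \<open>Among four increasing nonnegative numbers only the largest can reach the sum of the
  others, so the failure to form a quadrilateral is exactly the lower bound.\<close>

lemma admissible_if_quadrilateral_free:
  assumes free: "quadrilateral_free n x" and mono: "strict_mono_on {1..n} x"
    and nonneg: "\<And>i. i \<in> {1..n} \<Longrightarrow> 0 \<le> x i"
  shows "admissible n x"
  unfolding admissible_def
proof
  fix i assume i: "i \<in> {1..n}"
  have less: "x j < x k" if "1 \<le> j" "j < k" "k \<le> n" for j k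
    using mono that by (auto simp: strict_mono_on_def)
  consider "i \<le> 1" | "1 < i" "i \<le> 3" | "3 < i" by linarith
  then show "0 \<le> excess x i"
  proof cases
    case 1
    then show ?thesis using nonneg[OF i] by (simp add: admissible_lower_def)
  next
    case 2
    then have "x (i - 1) < x i" using i by (intro less) auto
    then show ?thesis using 2 by (simp add: admissible_lower_def)
  next
    case 3
    then have mem: "i - 3 \<in> {1..n}" "i - 2 \<in> {1..n}" "i - 1 \<in> {1..n}" "distinct [i - 3, i - 2, i - 1, i]"
      using i by auto
    then have "\<not> can_form_quadrilateral (x (i - 3)) (x (i - 2)) (x (i - 1)) (x i)"
      using free i unfolding quadrilateral_free_def by blast
    moreover have "x (i - 3) < x (i - 2)" "x (i - 2) < x (i - 1)" "x (i - 1) < x i"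
      using 3 i by (auto intro!: less)
    moreover have "0 \<le> x (i - 3)"
      using nonneg mem by blast
    ultimately show ?thesis
      using 3 by (auto simp: can_form_quadrilateral_def admissible_lower_def)
  qed
qed

section \<open>Sorting permutations: existence, uniqueness and counting\<close>

lemma ex_sorting_permutation:
  fixes x :: "nat \<Rightarrow> 'a :: linorder"
  assumes "inj_on x {1..n}"
  shows "\<exists>p. p permutes {1..n} \<and> strict_mono_on {1..n} (x \<circ> p)"
proof -
  define l where "l = sort_key x [1..<Suc n]"
  have l: "set l = {1..n}" "length l = n" "distinct l" "sorted (map x l)"
    unfolding l_def by auto
  \<comment> \<open>\<open>p i\<close> is the index of the \<open>i\<close>-th smallest entry; list
    positions start at 0, hence \<open>i - 1\<close>.\<close>
  define p where "p i = (if i \<in> {1..n} then l ! (i - 1) else i)" for i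
  have "bij_betw ((!) l \<circ> (\<lambda>i. i - 1)) {1..n} {1..n}"
  proof (rule bij_betw_trans)
    show "bij_betw (\<lambda>i. i - 1) {1..n} {..<n}"
      by (rule bij_betw_byWitness[of _ Suc]) auto
    show "bij_betw ((!) l) {..<n} {1..n}"
      by (rule bij_betw_nth) (use l in auto)
  qed
  then have "bij_betw p {1..n} {1..n}"
    by (subst bij_betw_cong[of _ _ "(!) l \<circ> (\<lambda>i. i - 1)"]) (auto simp: p_def)
  then have p: "p permutes {1..n}"
    by (rule bij_imp_permutes) (auto simp: p_def)
  moreover have "strict_mono_on {1..n} (x \<circ> p)"
  proof (rule strict_mono_onI)
    fix i j assume ij: "i \<in> {1..n}" "j \<in> {1..n}" "i < j"
    have "x (p i) \<le> x (p j)"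
      using sorted_nth_mono[OF l(4), of "i - 1" "j - 1"] ij l(2) by (simp add: p_def)
    moreover have "x (p i) \<noteq> x (p j)"
      using assms ij permutes_inj[OF p] permutes_in_image[OF p]
      by (metis inj_on_eq_iff inj_eq less_irrefl)
    ultimately show "(x \<circ> p) i < (x \<circ> p) j"
      by simp
  qed
  ultimately show ?thesis by blast
qed

text \<open>A sorting permutation is determined by the ranks, which gives its uniqueness.\<close>
lemma sorting_permutation_rank:
  fixes x :: "nat \<Rightarrow> 'a :: linorder"
  assumes "p permutes {1..n}" "strict_mono_on {1..n} (x \<circ> p)" "i \<in> {1..n}"
  shows "card {j \<in> {1..n}. x j \<le> x (p i)} = i"
proof -
  have "{j \<in> {1..n}. x j \<le> x (p i)} = {j \<in> p ` {1..n}. x j \<le> x (p i)}"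
    by (simp only: permutes_image[OF assms(1)])
  also have "\<dots> = p ` {k \<in> {1..n}. x (p k) \<le> x (p i)}"
    by auto
  also have "{k \<in> {1..n}. x (p k) \<le> x (p i)} = {1..i}"
    using strict_mono_on_less_eq[OF assms(2)] assms(3) by auto
  also have "card (p ` {1..i}) = i"
    using card_image[of p "{1..i}"] permutes_inj_on[OF assms(1)] by simp
  finally show ?thesis .
qed

lemma sorting_permutation_unique:
  fixes x :: "nat \<Rightarrow> 'a :: linorder"
  assumes p: "p permutes {1..n}" "strict_mono_on {1..n} (x \<circ> p)"
    and q: "q permutes {1..n}" "strict_mono_on {1..n} (x \<circ> q)"
  shows "p = q"
proof
  fix i
  show "p i = q i"
  proof (cases "i \<in> {1..n}")
    case True
    then have "p i \<in> q ` {1..n}"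
      using permutes_image[OF q(1)] permutes_in_image[OF p(1)] by blast
    then obtain k where k: "k \<in> {1..n}" "p i = q k" by blast
    \<comment> \<open>The common value \<open>x (p i) = x (q k)\<close> has only one rank.\<close>
    have "i = k"
      using sorting_permutation_rank[OF p True] sorting_permutation_rank[OF q k(1)] k(2) by simp
    then show ?thesis using k by simp
  next
    case False
    then show ?thesis
      using p(1) q(1) by (simp add: permutes_not_in)
  qed
qed

text \<open>Reindexing maps on the product space are written with a restriction, which this removes.
  No index outside \<open>{1..n}\<close> is read, since the bound at \<open>i = 1\<close> is
  constant.\<close>

lemma admissible_restrict [simp]: "admissible n (restrict x {1..n}) \<longleftrightarrow> admissible n x"
proof -
  have "excess (restrict x {1..n}) i = excess x i" if i: "i \<in> {1..n}" for i
  proof -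
    have "restrict x {1..n} i = x i"
      and "\<not> i \<le> 1 \<Longrightarrow> restrict x {1..n} (i - 1) = x (i - 1)"
      and "\<not> i \<le> 3 \<Longrightarrow> restrict x {1..n} (i - 1) = x (i - 1)"
      and "\<not> i \<le> 3 \<Longrightarrow> restrict x {1..n} (i - 2) = x (i - 2)"
      and "\<not> i \<le> 3 \<Longrightarrow> restrict x {1..n} (i - 3) = x (i - 3)"
      using i by auto
    then show ?thesis
      unfolding admissible_lower_def by (simp del: restrict_apply)
  qed
  then show ?thesis
    unfolding admissible_def by (intro ball_cong) (simp_all only:)
qed

text \<open>If there is no quadrilateral, the admissible rearrangements are the sorted ones, and
  there is exactly one; otherwise none is admissible, because rearranging keeps the quadrilateral.
  The indicator of the event thus becomes a sum over permutations.\<close>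

lemma card_admissible_permutations:
  assumes inj: "inj_on x {1..n}" and nonneg: "\<And>i. i \<in> {1..n} \<Longrightarrow> 0 \<le> x i"
  shows "card {p. p permutes {1..n} \<and> admissible n (x \<circ> p)} = (if quadrilateral_free n x then 1 else 0)"
proof (cases "quadrilateral_free n x")
  case True
  have iff: "admissible n (x \<circ> p) \<longleftrightarrow> strict_mono_on {1..n} (x \<circ> p)" if p: "p permutes {1..n}" for p
  proof
    assume adm: "admissible n (x \<circ> p)"
    have "inj_on (x \<circ> p) {1..n}"
      using inj permutes_inj_on[OF p] permutes_image[OF p] by (intro comp_inj_on) auto
    then show "strict_mono_on {1..n} (x \<circ> p)"
      using admissible_mono[OF adm]
      by (intro strict_mono_onI) (metis atLeastAtMost_iff inj_on_eq_iff less_le nless_le)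
  next
    assume "strict_mono_on {1..n} (x \<circ> p)"
    then show "admissible n (x \<circ> p)"
      using True nonneg permutes_in_image[OF p] quadrilateral_free_permute[OF p]
      by (intro admissible_if_quadrilateral_free) auto
  qed
  obtain p where "p permutes {1..n}" "strict_mono_on {1..n} (x \<circ> p)"
    using ex_sorting_permutation[OF inj] by blast
  then have "{p. p permutes {1..n} \<and> admissible n (x \<circ> p)} = {p}"
    using iff sorting_permutation_unique[of _ n x p] by blast
  then show ?thesis
    using True by simp
next
  case False
  then have "{p. p permutes {1..n} \<and> admissible n (x \<circ> p)} = {}"
    using quadrilateral_free_if_admissible quadrilateral_free_permute by blast
  then show ?thesis
    using False by (simp only: card.empty if_False)
qed

subsection \<open>Symmetrisation\<close>

lemma AE_uniform_power_component:
  assumes "i \<in> {1..n}"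
  shows "AE x in uniform_power n. 0 \<le> x i"
proof (rule AE_PiM_component)
  show "AE y in uniform_measure lborel {0..1::real}. 0 \<le> y"
    by (rule AE_uniform_measureI) auto
qed (use assms prob_space_uniform_unit in auto)

text \<open>By Fubini: with all coordinates but \<open>i\<close> fixed, the event confines
  coordinate \<open>i\<close> to a single point, which is a null set.\<close>

lemma AE_uniform_power_neq:
  assumes "i \<in> {1..n}" "j \<in> {1..n}" "i \<noteq> j"
  shows "AE x in uniform_power n. x i \<noteq> x j"
proof -
  interpret V: product_sigma_finite "\<lambda>_ :: nat. uniform_measure lborel {0..1::real}"
    using prob_space_uniform_unit by (simp add: product_sigma_finite_def prob_space_imp_sigma_finite)
  let ?K = "{1..n} - {i}" and ?u = "uniform_measure lborel {0..1::real}"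
  have K: "insert i ?K = {1..n}" using assms by auto
  have comp [measurable]: "(\<lambda>x. x k) \<in> borel_measurable (uniform_power n)" if "k \<in> {1..n}" for k
    unfolding measurable_cong_sets[OF sets_uniform_power refl]
    by (rule measurable_component_singleton) (use that in auto)
  have set: "{x \<in> space (uniform_power n). x i = x j} \<in> sets (uniform_power n)"
    using comp[OF assms(1)] comp[OF assms(2)] by measurable
  have null: "emeasure ?u {c} = 0" for c
    by (simp add: emeasure_uniform_measure emeasure_lborel_countable)
  have "emeasure (uniform_power n) {x \<in> space (uniform_power n). x i = x j}
      = (\<integral>\<^sup>+x. indicator {x \<in> space (uniform_power n). x i = x j} x \<partial>uniform_power n)"
    using set by simp
  also have "\<dots> = (\<integral>\<^sup>+x. (\<integral>\<^sup>+y. indicator {x \<in> space (uniform_power n). x i = x j} (x(i := y)) \<partial>?u)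
      \<partial>Pi\<^sub>M ?K (\<lambda>_. ?u))"
    using V.product_nn_integral_insert[of ?K i "indicator {x \<in> space (uniform_power n). x i = x j}"] set
    unfolding K by simp
  also have "\<dots> \<le> (\<integral>\<^sup>+x. (\<integral>\<^sup>+y. indicator {x j} y \<partial>?u) \<partial>Pi\<^sub>M ?K (\<lambda>_. ?u))"
    using assms by (intro nn_integral_mono) (auto split: split_indicator)
  also have "\<dots> = 0"
    by (simp add: null)
  finally show ?thesis
    using set by (subst AE_iff_measurable) auto
qed

lemma AE_uniform_power_inj_nonneg:
  "AE x in uniform_power n. inj_on x {1..n} \<and> (\<forall>i\<in>{1..n}. 0 \<le> x i)"
proof -
  have "AE x in uniform_power n. \<forall>i\<in>{1..n}. \<forall>j\<in>{1..n}. i \<noteq> j \<longrightarrow> x i \<noteq> x j"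
    using AE_uniform_power_neq by (auto simp: AE_finite_all AE_all_countable)
  moreover have "AE x in uniform_power n. \<forall>i\<in>{1..n}. 0 \<le> x i"
    using AE_uniform_power_component by (auto simp: AE_finite_all)
  ultimately show ?thesis
    by eventually_elim (auto simp: inj_on_def)
qed

lemma measurable_quadrilateral_free:
  assumes "sets (N :: (nat \<Rightarrow> real) measure) = sets (Pi\<^sub>M {1..n} (\<lambda>_. borel))"
  shows "Measurable.pred N (quadrilateral_free n)"
proof -
  have [measurable]: "(\<lambda>x. x i) \<in> borel_measurable N" if "i \<in> {1..n}" for i
    unfolding measurable_cong_sets[OF assms refl]
    by (rule measurable_component_singleton) (use that in auto)
  show ?thesis
    unfolding quadrilateral_free_def[abs_def] can_form_quadrilateral_def by measurable
qed

lemma nn_integral_of_bool: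
  "Measurable.pred N P \<Longrightarrow> (\<integral>\<^sup>+x. of_bool (P x) \<partial>N) = emeasure N {x \<in> space N. P x}"
  by (auto simp: pred_def simp flip: nn_integral_indicator intro!: nn_integral_cong split: split_indicator)

text \<open>All factors of the product measure are equal, so permuting the coordinates preserves
  it.\<close>

lemma emeasure_admissible_permute:
  assumes "p permutes {1..n}"
  shows "(\<integral>\<^sup>+x. of_bool (admissible n (x \<circ> p)) \<partial>uniform_power n)
       = emeasure (uniform_power n) {x \<in> space (uniform_power n). admissible n x}"
proof -
  note [measurable] = measurable_admissible[OF sets_uniform_power]
  let ?t = "\<lambda>x :: nat \<Rightarrow> real. \<lambda>i\<in>{1..n}. x (p i)"
  have distr: "distr (uniform_power n) (uniform_power n) ?t = uniform_power n"
    using distr_PiM_reindex[of "{1..n}" "\<lambda>_. uniform_measure lborel {0..1::real}" p "{1..n}"]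
      prob_space_uniform_unit permutes_inj_on[OF assms] permutes_in_image[OF assms] by auto
  have t: "?t \<in> measurable (uniform_power n) (uniform_power n)"
    using permutes_in_image[OF assms]
    by (intro measurable_restrict measurable_component_singleton) auto
  have "emeasure (uniform_power n) {x \<in> space (uniform_power n). admissible n x}
      = (\<integral>\<^sup>+x. of_bool (admissible n x) \<partial>uniform_power n)"
    by (rule nn_integral_of_bool[symmetric]) measurable
  also have "\<dots> = (\<integral>\<^sup>+x. of_bool (admissible n x) \<partial>distr (uniform_power n) (uniform_power n) ?t)"
    by (simp only: distr)
  also have "\<dots> = (\<integral>\<^sup>+x. of_bool (admissible n (?t x)) \<partial>uniform_power n)"
    by (rule nn_integral_distr[OF t]) measurable
  also have "\<dots> = (\<integral>\<^sup>+x. of_bool (admissible n (x \<circ> p)) \<partial>uniform_power n)"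
    by (simp only: admissible_restrict o_def)
  finally show ?thesis ..
qed

lemma emeasure_quadrilateral_free:
  assumes "n \<ge> 3"
  shows "emeasure (uniform_power n) {x \<in> space (uniform_power n). quadrilateral_free n x}
       = ennreal (1 / (\<Prod>i=1..n. weight n i))"
proof -
  note [measurable] = measurable_quadrilateral_free[OF sets_uniform_power]
  let ?P = "{p. p permutes {1..n}}"
  have fin: "finite ?P"
    by (rule finite_permutations) simp
  have meas: "(\<lambda>x. of_bool (admissible n (x \<circ> p)) :: ennreal) \<in> borel_measurable (uniform_power n)"
    if p: "p permutes {1..n}" for p
  proof -
    note [measurable] = measurable_admissible[OF sets_uniform_power]
    have [measurable]: "(\<lambda>x :: nat \<Rightarrow> real. \<lambda>i\<in>{1..n}. x (p i)) \<in> measurable (uniform_power n) (uniform_power n)"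
      using permutes_in_image[OF p]
      by (intro measurable_restrict measurable_component_singleton) auto
    have "(\<lambda>x. of_bool (admissible n (\<lambda>i\<in>{1..n}. x (p i))) :: ennreal) \<in> borel_measurable (uniform_power n)"
      by measurable
    then show ?thesis
      by (simp only: admissible_restrict o_def)
  qed
  have "emeasure (uniform_power n) {x \<in> space (uniform_power n). quadrilateral_free n x}
      = (\<integral>\<^sup>+x. of_bool (quadrilateral_free n x) \<partial>uniform_power n)"
    by (rule nn_integral_of_bool[symmetric]) measurable
  \<comment> \<open>The counting identity needs distinct nonnegative entries, so it holds only
    almost everywhere.\<close>
  also have "\<dots> = (\<integral>\<^sup>+x. (\<Sum>p\<in>?P. of_bool (admissible n (x \<circ> p))) \<partial>uniform_power n)"
  proof (rule nn_integral_cong_AE)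
    show "AE x in uniform_power n.
        of_bool (quadrilateral_free n x) = (\<Sum>p\<in>?P. of_bool (admissible n (x \<circ> p)) :: ennreal)"
      using AE_uniform_power_inj_nonneg
    proof eventually_elim
      case (elim x)
      have "(\<Sum>p\<in>?P. of_bool (admissible n (x \<circ> p)) :: ennreal)
          = of_nat (card (?P \<inter> {p. admissible n (x \<circ> p)}))"
        using fin fin by (rule sum_of_bool_eq)
      also have "?P \<inter> {p. admissible n (x \<circ> p)} = {p. p permutes {1..n} \<and> admissible n (x \<circ> p)}"
        by auto
      finally show ?case
        using card_admissible_permutations[of x n] elim by (simp only: of_bool_def) simp
    qed
  qed
  also have "\<dots> = (\<Sum>p\<in>?P. \<integral>\<^sup>+x. of_bool (admissible n (x \<circ> p)) \<partial>uniform_power n)"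
    by (rule nn_integral_sum) (use meas in auto)
  also have "\<dots> = (\<Sum>p\<in>?P. ennreal (1 / (fact n * (\<Prod>i=1..n. weight n i))))"
    by (intro sum.cong refl) (simp only: mem_Collect_eq emeasure_admissible_permute emeasure_admissible[OF assms])
  \<comment> \<open>All n! permutations contribute equally; this n! cancels the one in the simplex
    volume.\<close>
  also have "\<dots> = ennreal (fact n * (1 / (fact n * (\<Prod>i=1..n. weight n i))))"
  proof -
    have "card ?P = fact n"
      by (rule card_permutations) auto
    then have "of_nat (card ?P) = ennreal (fact n)"
      by (simp add: ennreal_of_nat_eq_real_of_nat)
    then show ?thesis
      unfolding sum_constant by (simp only: ennreal_mult' fact_ge_zero)
  qed
  finally show ?thesis
    by simp
qed

section \<open>Transfer to independent uniform random variables\<close>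

theorem theorem2:
  fixes M :: "'a measure" and U :: "nat \<Rightarrow> 'a \<Rightarrow> real" and n :: nat
  assumes "prob_space M"
    and "n \<ge> 3"
    and "prob_space.indep_vars M (\<lambda>_. borel) U {1..n}"
    and "\<And>i. i \<in> {1..n} \<Longrightarrow> distr M borel (U i) = uniform_measure lborel {0..1}"
  shows "measure M {\<omega> \<in> space M.
           \<not> (\<exists>a\<in>{1..n}. \<exists>b\<in>{1..n}. \<exists>c\<in>{1..n}. \<exists>d\<in>{1..n}. distinct [a, b, c, d] \<and>
                can_form_quadrilateral (U a \<omega>) (U b \<omega>) (U c \<omega>) (U d \<omega>))}
         = 1 / (real (tribonacci n) - real (tribonacci (n - 2))) *
           (\<Prod>i=1..n - 1. 1 / real (tribonacci i))"
proof -
  interpret prob_space M by fact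
  let ?X = "\<lambda>\<omega>. \<lambda>i\<in>{1..n}. U i \<omega>" and ?B = "Pi\<^sub>M {1..n} (\<lambda>_. borel :: real measure)"
  have U: "U i \<in> borel_measurable M" if "i \<in> {1..n}" for i
    using assms(3) that by (auto simp: indep_vars_def)
  have X: "?X \<in> measurable M ?B"
    using U by (intro measurable_restrict) auto
  \<comment> \<open>Independence means that the joint law is the product of the marginal
    laws.\<close>
  have "distr M ?B ?X = Pi\<^sub>M {1..n} (\<lambda>i. distr M borel (U i))"
    using assms(2,3) U by (subst indep_vars_iff_distr_eq_PiM'[symmetric]) auto
  also have "\<dots> = uniform_power n"
    using assms(4) by (intro PiM_cong) auto
  finally have distr: "distr M ?B ?X = uniform_power n" .
  have space: "space (uniform_power n) = space ?B"
    using sets_uniform_power by (rule sets_eq_imp_space_eq)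
  let ?Q = "{x \<in> space ?B. quadrilateral_free n x}"
  have Q: "?Q \<in> sets ?B"
    using measurable_quadrilateral_free[OF refl, of n] by (simp add: pred_def)
  have "{\<omega> \<in> space M. quadrilateral_free n (\<lambda>i. U i \<omega>)} = ?X -` ?Q \<inter> space M"
    using measurable_space[OF X] by (auto simp: quadrilateral_free_def)
  then have "measure M {\<omega> \<in> space M. quadrilateral_free n (\<lambda>i. U i \<omega>)} = measure (uniform_power n) ?Q"
    unfolding distr[symmetric] by (simp only: measure_distr[OF X Q])
  also have "\<dots> = 1 / (\<Prod>i=1..n. weight n i)"
    using emeasure_quadrilateral_free[OF assms(2)] weight_pos[OF assms(2)]
    unfolding measure_def space
    by (simp only:) (intro enn2real_ennreal divide_nonneg_nonneg prod_nonneg, auto intro: less_imp_le)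
  also have "\<dots> = 1 / (real (tribonacci n) - real (tribonacci (n - 2))) *
           (\<Prod>i=1..n - 1. 1 / real (tribonacci i))"
    using assms(2) prod_weight[of n] by (simp add: prod_dividef)
  finally show ?thesis
    unfolding quadrilateral_free_def .
qed

end
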